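(* Let $\{m_{ij}\}_{1\le i<j\le n}$ be a collection of positive integers. Then the specialization $$q_{ij}\longmapsto[m_{ij}]_y:=\frac{y^{m_{ij}}-1}{y-1}$$ of the universal Tutte polynomial $T_n(\{q_{ij}\},x,y)$ is equal to the Tutte polynomial of the complete graph $K_n$ in which each edge $(i,j)$ is taken with multiplicity $m_{ij}$.
   Context: The universal Tutte polynomial $T_n(\{q_{ij}\},x,y)\in\mathbb{Z}[\{q_{ij}\}_{1\le i<j\le n},x,y]$ is defined by $$(x-1)\,T_n(\{q_{ij}\},x,y)=\mathrm{Coeff}_{[t_1\cdots t_n]}\left[\Bigl(\sum_{\ell_1,\dots,\ell_n\in\{0,1\}}\ \prod_{1\le i<j\le n}(q_{ij}(y-1)+1)^{\ell_i\ell_j}\,(y-1)^{-\sum_j\ell_j}\,t_1^{\ell_1}\cdots t_n^{\ell_n}\Bigr)^{(x-1)(y-1)}\right],$$ where $\mathrm{Coeff}_{[t_1\cdots t_n]}$ denotes the coefficient of the monomial $t_1t_2\cdots t_n$ and the power is that of a formal power series with constant term $1$. The Tutte polynomial of a graph $\Gamma=(V,E)$ is $\sum_{A\subset E}(x-1)^{\kappa(A)-\kappa(E)}(y-1)^{\kappa(A)+|A|-|V|}$, with $\kappa(A)$ the number of connected components of $(V,A)$. *)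

theory Defs
  imports
    "HOL-Library.Poly_Mapping"
    "HOL-Library.Countable"
    "HOL-Library.FuncSet"
    "HOL-Computational_Algebra.Computational_Algebra"
begin

section \<open>The polynomial ring in the variables \<open>q\<^sub>i\<^sub>j\<close>, \<open>x\<close>, \<open>y\<close>\<close>

text \<open>Multivariate polynomials are finitely supported maps from monomials to coefficients,
  monomials being finitely supported maps from variables to exponents.\<close>

type_synonym ('v, 'a) mpoly = "('v \<Rightarrow>\<^sub>0 nat) \<Rightarrow>\<^sub>0 'a"

datatype tvar = Qv nat nat | Xv | Yv

instance tvar :: countable
  by countable_datatype

text \<open>The order on variables has no mathematical meaning: the library derives that a polynomial
  ring is an integral domain from a linear order on the variables.\<close>

instantiation tvar :: linorder
begin

definition less_eq_tvar :: "tvar \<Rightarrow> tvar \<Rightarrow> bool"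
  where "less_eq_tvar v w \<longleftrightarrow> to_nat v \<le> to_nat w"

definition less_tvar :: "tvar \<Rightarrow> tvar \<Rightarrow> bool"
  where "less_tvar v w \<longleftrightarrow> to_nat v < to_nat w"

instance
  by standard (auto simp: less_eq_tvar_def less_tvar_def)

end

definition mpoly_var :: "'v \<Rightarrow> ('v, 'a::comm_semiring_1) mpoly"
  where "mpoly_var v = Poly_Mapping.single (Poly_Mapping.single v 1) 1"

definition mpoly_vars :: "('v, 'a::zero) mpoly \<Rightarrow> 'v set"
  where "mpoly_vars p = (\<Union>\<mu> \<in> Poly_Mapping.keys p. Poly_Mapping.keys \<mu>)"

definition mpoly_subst :: "('v \<Rightarrow> 'b::comm_ring_1) \<Rightarrow> ('v, int) mpoly \<Rightarrow> 'b"
  where "mpoly_subst f p =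
    (\<Sum>\<mu> \<in> Poly_Mapping.keys p. of_int (Poly_Mapping.lookup p \<mu>) * (\<Prod>v \<in> Poly_Mapping.keys \<mu>. f v ^ Poly_Mapping.lookup \<mu> v))"

instance fract :: ("{idom, ring_char_0}") field_char_0
proof
  show "inj (of_nat :: nat \<Rightarrow> 'a fract)"
    by (rule injI) (simp add: of_nat_fract eq_fract)
qed

abbreviation qF :: "nat \<Rightarrow> nat \<Rightarrow> (tvar, int) mpoly fract"
  where "qF i j \<equiv> to_fract (mpoly_var (Qv i j))"

abbreviation xF :: "(tvar, int) mpoly fract"
  where "xF \<equiv> to_fract (mpoly_var Xv)"

abbreviation yF :: "(tvar, int) mpoly fract"
  where "yF \<equiv> to_fract (mpoly_var Yv)"


section \<open>The universal Tutte polynomial\<close>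

definition index_pairs :: "nat \<Rightarrow> (nat \<times> nat) set"
  where "index_pairs n = {(i, j). 1 \<le> i \<and> i < j \<and> j \<le> n}"

text \<open>\<open>F\<^sup>\<alpha>\<close> is the formal power series \<open>\<Sum>k. (\<alpha> gchoose k) (F - 1)\<^sup>k\<close>, represented by its
  coefficient function. It is meant for \<open>F\<close> with constant term 1: then \<open>(F - 1)\<^sup>k\<close> has no monomials
  of total degree less than \<open>k\<close>, so that for each monomial only finitely many terms are nonzero, as
  required by \<^const>\<open>Sum_any\<close>.\<close>

definition series_power :: "('v, 'a::field_char_0) mpoly \<Rightarrow> 'a \<Rightarrow> ('v \<Rightarrow>\<^sub>0 nat) \<Rightarrow> 'a"
  where "series_power F \<alpha> \<mu> = Sum_any (\<lambda>k. (\<alpha> gchoose k) * Poly_Mapping.lookup ((F - 1) ^ k) \<mu>)"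

text \<open>The formal variables \<open>t\<^sub>1, \<dots>, t\<^sub>n\<close> are indexed by natural numbers; the coefficients lie in the
  fraction field because of the negative powers of \<open>y - 1\<close>.\<close>

definition tutte_base :: "nat \<Rightarrow> (nat, (tvar, int) mpoly fract) mpoly"
  where "tutte_base n = (\<Sum>l \<in> {1..n} \<rightarrow>\<^sub>E {0, 1::nat}.
    Poly_Mapping.single (\<Sum>j \<in> {1..n}. Poly_Mapping.single j (l j))
      ((\<Prod>(i, j) \<in> index_pairs n. (qF i j * (yF - 1) + 1) ^ (l i * l j))
        * (yF - 1) powi (- (\<Sum>j \<in> {1..n}. int (l j)))))"

definition universal_tutte :: "nat \<Rightarrow> (tvar, int) mpoly"
  where "universal_tutte n = (THE T.
    mpoly_vars T \<subseteq> {Qv i j |i j. (i, j) \<in> index_pairs n} \<union> {Xv, Yv} \<and>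
    (xF - 1) * to_fract T =
      series_power (tutte_base n) ((xF - 1) * (yF - 1))
        (\<Sum>j \<in> {1..n}. Poly_Mapping.single j 1))"


section \<open>The Tutte polynomial of a multigraph\<close>

text \<open>An edge \<open>e\<close> has the set \<open>ends e\<close> of one (loop) or two end vertices; distinct edges may
  have the same ends.\<close>

record ('v, 'e) multigraph =
  verts :: "'v set"
  edges :: "'e set"
  ends :: "'e \<Rightarrow> 'v set"

definition same_component :: "('v, 'e) multigraph \<Rightarrow> 'e set \<Rightarrow> ('v \<times> 'v) set"
  where "same_component G A =
    {(u, v) \<in> verts G \<times> verts G. (u, v) \<in> {(a, b). \<exists>e \<in> A. ends G e = {a, b}}\<^sup>*}"

definition num_components :: "('v, 'e) multigraph \<Rightarrow> 'e set \<Rightarrow> nat"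
  where "num_components G A = card (verts G // same_component G A)"

text \<open>\<open>\<int>[x, y]\<close> is the type \<^typ>\<open>int poly poly\<close>, with \<open>y\<close> the outer variable.\<close>

definition x_poly :: "int poly poly"
  where "x_poly = [:[:0, 1:]:]"

definition y_poly :: "int poly poly"
  where "y_poly = [:0, 1:]"

text \<open>The natural number subtractions in the exponents do not truncate: for \<open>A \<subseteq> edges G\<close> the
  graph \<open>(V, A)\<close> has at least as many components as \<open>G\<close> and at least \<open>|V| - |A|\<close> many.\<close>

definition tutte_poly :: "('v, 'e) multigraph \<Rightarrow> int poly poly"
  where "tutte_poly G = (\<Sum>A \<in> Pow (edges G).
    (x_poly - 1) ^ (num_components G A - num_components G (edges G))
    * (y_poly - 1) ^ (num_components G A + card A - card (verts G)))"

definition complete_multigraph ::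
    "nat \<Rightarrow> (nat \<Rightarrow> nat \<Rightarrow> nat) \<Rightarrow> (nat, nat \<times> nat \<times> nat) multigraph"
  where "complete_multigraph n m =
    \<lparr>verts = {1..n},
     edges = {(i, j, k). (i, j) \<in> index_pairs n \<and> k < m i j},
     ends = (\<lambda>(i, j, k). {i, j})\<rparr>"


section \<open>The specialization\<close>

text \<open>The division in \<open>\<int>[x, y]\<close> is exact.\<close>

definition y_number :: "nat \<Rightarrow> int poly poly"
  where "y_number k = (y_poly ^ k - 1) div (y_poly - 1)"

definition specialize :: "(nat \<Rightarrow> nat \<Rightarrow> int poly poly) \<Rightarrow> (tvar, int) mpoly \<Rightarrow> int poly poly"
  where "specialize c = mpoly_subst
    (\<lambda>v. case v of Qv i j \<Rightarrow> c i j | Xv \<Rightarrow> x_poly | Yv \<Rightarrow> y_poly)"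

end

theory Submission
  imports Defs
begin

text \<open>
  Write \<open>F\<close> for the generating function in the definition of the universal Tutte polynomial and
  \<open>z = y - 1\<close>. For a natural number \<open>k\<close>, the coefficient of \<open>t\<^sub>1 \<cdots> t\<^sub>n\<close> in \<open>F\<^sup>k\<close> is a sum over the colourings
  of \<open>{1, \<dots>, n}\<close> with \<open>k\<close> colours, the colour of a vertex telling from which factor \<open>F\<close> its variable is
  taken. A colouring contributes \<open>z^(-n)\<close> times the product of \<open>1 + q\<^sub>i\<^sub>j z\<close> over the monochromatic pairs.
  Expanding this product into a sum over sets \<open>A\<close> of pairs and exchanging the sums, each \<open>A\<close> gets
  counted once for every colouring that is constant on its components, that is, \<open>k^\<kappa>(A)\<close> times. So the
  coefficient is \<open>\<Sum>A. k^\<kappa>(A) z^(-n) \<Prod>(i, j)\<in>A. q\<^sub>i\<^sub>j z\<close>. This is a polynomial in \<open>k\<close>, and so is the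
  coefficient in \<open>F\<^sup>\<alpha>\<close> in \<open>\<alpha>\<close>; both agree at all natural numbers and hence everywhere
  (lemma \<open>series_power_tutte_base\<close>). For \<open>\<alpha> = (x - 1) z\<close>, dividing by \<open>x - 1\<close> gives
  \<open>\<Sum>A. (x - 1)^(\<kappa>(A) - 1) * (y - 1)^(\<kappa>(A) + |A| - n) * (\<Prod>(i, j)\<in>A. q\<^sub>i\<^sub>j)\<close>
  for the universal Tutte polynomial, which is a genuine polynomial because \<open>\<kappa>(A) \<ge> 1\<close> and \<open>\<kappa>(A) + |A| \<ge> n\<close>
  (lemma \<open>universal_tutte_eq_subgraph_expansion\<close>).

  On the other side, the number of components of a set \<open>B\<close> of edges of the multigraph depends only on
  its support, the set \<open>A\<close> of pairs that are joined by an edge of \<open>B\<close>. The sets \<open>B\<close> with support \<open>A\<close>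
  arise by choosing a nonempty set of parallel edges for each pair in \<open>A\<close>, so that their weights
  \<open>z^|B|\<close> sum to \<open>\<Prod>(i, j)\<in>A. (z + 1)^m\<^sub>i\<^sub>j - 1\<close>, which is the product of \<open>[m\<^sub>i\<^sub>j]\<^sub>y z\<close>
  (lemma \<open>sum_power_card_support\<close>). Since the whole multigraph is connected, its Tutte polynomial is
  the expansion above at \<open>q\<^sub>i\<^sub>j = [m\<^sub>i\<^sub>j]\<^sub>y\<close>.
\<close>

section \<open>Coefficients of squarefree monomials\<close>

definition squarefree_monomial :: "'v set \<Rightarrow> 'v \<Rightarrow>\<^sub>0 nat"
  where "squarefree_monomial S = (\<Sum>v\<in>S. Poly_Mapping.single v 1)"

lemma lookup_squarefree_monomial:
  assumes "finite S"
  shows "Poly_Mapping.lookup (squarefree_monomial S) v = (if v \<in> S then 1 else 0)"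
  using assms by (simp add: squarefree_monomial_def lookup_sum lookup_single when_def)

lemma squarefree_monomial_empty [simp]: "squarefree_monomial {} = 0"
  by (simp add: squarefree_monomial_def)

lemma squarefree_monomial_eq_iff:
  assumes "finite S" "finite T"
  shows "squarefree_monomial S = squarefree_monomial T \<longleftrightarrow> S = T"
proof
  assume eq: "squarefree_monomial S = squarefree_monomial T"
  have "v \<in> S \<longleftrightarrow> v \<in> T" for v
    using arg_cong[OF eq, of "\<lambda>\<mu>. Poly_Mapping.lookup \<mu> v"] assms
    by (simp add: lookup_squarefree_monomial split: if_splits)
  then show "S = T" by blast
qed simp

lemma squarefree_monomial_split:
  assumes "finite S" "T \<subseteq> S"
  shows "squarefree_monomial S = squarefree_monomial T + squarefree_monomial (S - T)"
  unfolding squarefree_monomial_def using sum.subset_diff[OF assms(2,1)]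
  by (subst add.commute)

text \<open>Splitting a squarefree monomial into two factors means distributing its variables: every
  divisor of it is the squarefree monomial of a subset.\<close>

lemma lookup_mult_squarefree:
  fixes P Q :: "('v, 'a::comm_semiring_1) mpoly"
  assumes "finite S"
  shows "Poly_Mapping.lookup (P * Q) (squarefree_monomial S) =
    (\<Sum>T\<in>Pow S. Poly_Mapping.lookup P (squarefree_monomial T)
      * Poly_Mapping.lookup Q (squarefree_monomial (S - T)))"
proof -
  define inner where
    "inner l = (\<Sum>q. Poly_Mapping.lookup Q q when squarefree_monomial S = l + q)" for l
  have inner: "inner (squarefree_monomial T)
      = Poly_Mapping.lookup Q (squarefree_monomial (S - T))" if "T \<subseteq> S" for T
  proof -
    have "squarefree_monomial S = squarefree_monomial T + q \<longleftrightarrow> squarefree_monomial (S - T) = q"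
      for q
      using squarefree_monomial_split[OF assms that] by (simp add: add_left_cancel)
    then show ?thesis by (simp add: inner_def)
  qed
  have inner_0: "inner l = 0" if l: "l \<notin> squarefree_monomial ` Pow S" for l
  proof -
    have "squarefree_monomial S \<noteq> l + q" for q
    proof
      assume eq: "squarefree_monomial S = l + q"
      have val: "Poly_Mapping.lookup l v + Poly_Mapping.lookup q v = (if v \<in> S then 1 else 0)" for v
        using arg_cong[OF eq, of "\<lambda>\<mu>. Poly_Mapping.lookup \<mu> v"] assms
        by (simp add: lookup_squarefree_monomial lookup_add)
      have "Poly_Mapping.keys l \<subseteq> S"
        using val by (force simp: in_keys_iff split: if_splits)
      moreover have "l = squarefree_monomial (Poly_Mapping.keys l)"
      proof (rule poly_mapping_eqI)
        fix v
        show "Poly_Mapping.lookup l v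
            = Poly_Mapping.lookup (squarefree_monomial (Poly_Mapping.keys l)) v"
          using val[of v] by (auto simp: lookup_squarefree_monomial in_keys_iff split: if_splits)
      qed
      ultimately show False using l by blast
    qed
    then show ?thesis by (simp add: inner_def)
  qed
  have "Poly_Mapping.lookup (P * Q) (squarefree_monomial S)
      = Sum_any (\<lambda>l. Poly_Mapping.lookup P l * inner l)"
    by (simp add: lookup_mult inner_def)
  also have "\<dots> = (\<Sum>l\<in>squarefree_monomial ` Pow S. Poly_Mapping.lookup P l * inner l)"
    using assms inner_0 by (intro Sum_any.expand_superset) fastforce+
  also have "\<dots> = (\<Sum>T\<in>Pow S. Poly_Mapping.lookup P (squarefree_monomial T)
      * inner (squarefree_monomial T))"
    using assms by (subst sum.reindex)
      (auto simp: inj_on_def squarefree_monomial_eq_iff finite_subset)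
  finally show ?thesis by (simp add: inner)
qed

text \<open>Iterating the previous lemma, the variables are distributed among \<open>k\<close> numbered factors. Such a
  distribution is a colouring with \<open>k\<close> colours.\<close>

lemma lookup_power_squarefree:
  fixes P :: "('v, 'a::comm_semiring_1) mpoly"
  assumes "finite S"
  shows "Poly_Mapping.lookup (P ^ k) (squarefree_monomial S) =
    (\<Sum>c \<in> S \<rightarrow>\<^sub>E {..<k}. \<Prod>i<k. Poly_Mapping.lookup P (squarefree_monomial {v \<in> S. c v = i}))"
  using assms
proof (induction k arbitrary: S)
  case 0
  then show ?case
    using squarefree_monomial_eq_iff[of S "{}"]
    by (cases "S = {}") (simp_all add: lookup_one when_def card_PiE zero_power card_gt_0_iff)
next
  case (Suc k)
  let ?w = "\<lambda>T. Poly_Mapping.lookup P (squarefree_monomial T)"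
  have "Poly_Mapping.lookup (P ^ Suc k) (squarefree_monomial S) =
      (\<Sum>T\<in>Pow S. \<Sum>c \<in> (S - T) \<rightarrow>\<^sub>E {..<k}. ?w T * (\<Prod>i<k. ?w {v \<in> S - T. c v = i}))"
    using Suc by (simp add: lookup_mult_squarefree sum_distrib_left)
  also have "\<dots> = (\<Sum>(T, c) \<in> (SIGMA T:Pow S. (S - T) \<rightarrow>\<^sub>E {..<k}).
      ?w T * (\<Prod>i<k. ?w {v \<in> S - T. c v = i}))"
    using Suc.prems by (subst sum.Sigma) (auto intro!: finite_PiE)
  also have "\<dots> = (\<Sum>c \<in> S \<rightarrow>\<^sub>E {..<Suc k}. \<Prod>i<Suc k. ?w {v \<in> S. c v = i})"
  \<comment> \<open>\<open>T\<close> is the set of variables that the additional factor takes; they receive the new colour \<open>k\<close>.\<close>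
  proof (rule sum.reindex_bij_witness[where
        i = "\<lambda>c. ({v \<in> S. c v = k}, restrict c {v \<in> S. c v \<noteq> k})"
        and j = "\<lambda>(T, c). \<lambda>v. if v \<in> T then k else c v"], goal_cases)
    case (1 a)
    then obtain T c where a: "a = (T, c)" "T \<subseteq> S" and c: "c \<in> (S - T) \<rightarrow>\<^sub>E {..<k}" by auto
    have "c v \<noteq> k" if "v \<in> S - T" for v using c that by fastforce
    then have *: "{v \<in> S. (if v \<in> T then k else c v) = k} = T"
      "{v \<in> S. (if v \<in> T then k else c v) \<noteq> k} = S - T"
      using a(2) by auto
    have "restrict (\<lambda>v. if v \<in> T then k else c v) (S - T) = c"
      using c by (auto simp: fun_eq_iff restrict_def PiE_def extensional_def)
    with * show ?case by (simp add: a(1))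
  next
    case (2 a)
    then obtain T c where a: "a = (T, c)" "T \<subseteq> S" and c: "c \<in> (S - T) \<rightarrow>\<^sub>E {..<k}" by auto
    show ?case unfolding a(1) prod.case
    proof (rule PiE_I)
      fix v assume "v \<in> S"
      then show "(if v \<in> T then k else c v) \<in> {..<Suc k}"
        using c by (cases "v \<in> T") (auto dest!: PiE_mem[where x = v])
    next
      fix v assume "v \<notin> S"
      then show "(if v \<in> T then k else c v) = undefined"
        using c a(2) by (auto simp: PiE_def extensional_def)
    qed
  next
    case (3 c)
    have "(if v \<in> {v \<in> S. c v = k} then k else restrict c {v \<in> S. c v \<noteq> k} v) = c v" for v
      using 3 PiE_arb[OF 3, of v] by (cases "v \<in> S") simp_all
    then show ?case by auto
  next
    case (4 c)
    have "restrict c {v \<in> S. c v \<noteq> k} \<in> (S - {v \<in> S. c v = k}) \<rightarrow>\<^sub>E {..<k}"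
    proof (rule PiE_I)
      fix v assume "v \<in> S - {v \<in> S. c v = k}"
      moreover from this have "c v \<in> {..<Suc k}" using 4 by blast
      ultimately show "restrict c {v \<in> S. c v \<noteq> k} v \<in> {..<k}" by auto
    qed auto
    then show ?case by auto
  next
    case (5 a)
    then obtain T c where a: "a = (T, c)" "T \<subseteq> S" and c: "c \<in> (S - T) \<rightarrow>\<^sub>E {..<k}" by auto
    have "c v \<noteq> k" if "v \<in> S - T" for v using c that by fastforce
    then have "{v \<in> S. (if v \<in> T then k else c v) = k} = T"
      using a(2) by auto
    moreover have "{v \<in> S. (if v \<in> T then k else c v) = i} = {v \<in> S - T. c v = i}" if "i < k" for i
      using that a(2) by auto
    ultimately show ?case
      by (simp add: a(1) mult.commute)
  qed
  finally show ?case .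
qed

section \<open>Powers with arbitrary exponents\<close>

text \<open>A colouring with more colours than variables misses a colour, and the factor of that colour
  contributes its vanishing constant term. Hence the sum that defines \<^const>\<open>series_power\<close> is finite at
  squarefree monomials.\<close>

lemma lookup_power_squarefree_eq_0:
  fixes P :: "('v, 'a::comm_semiring_1) mpoly"
  assumes "finite S" and "Poly_Mapping.lookup P 0 = 0" and "card S < k"
  shows "Poly_Mapping.lookup (P ^ k) (squarefree_monomial S) = 0"
proof -
  have "(\<Prod>i<k. Poly_Mapping.lookup P (squarefree_monomial {v \<in> S. c v = i})) = 0"
    for c :: "'v \<Rightarrow> nat"
  proof -
    have "\<not> {..<k} \<subseteq> c ` S"
      using assms card_image_le[of S c] card_mono[of "c ` S" "{..<k}"] by auto
    then obtain i where "i < k" "{v \<in> S. c v = i} = {}" by blast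
    then have "Poly_Mapping.lookup P (squarefree_monomial {v \<in> S. c v = i}) = 0"
      using assms(2) by (simp only: squarefree_monomial_empty)
    with \<open>i < k\<close> show ?thesis by (auto intro!: prod_zero)
  qed
  then show ?thesis by (simp add: lookup_power_squarefree assms(1))
qed

lemma series_power_squarefree:
  fixes F :: "('v, 'a::field_char_0) mpoly"
  assumes "finite S" and "Poly_Mapping.lookup F 0 = 1"
  shows "series_power F \<alpha> (squarefree_monomial S) =
    (\<Sum>k\<le>card S. (\<alpha> gchoose k) * Poly_Mapping.lookup ((F - 1) ^ k) (squarefree_monomial S))"
  unfolding series_power_def
proof (rule Sum_any.expand_superset)
  have "Poly_Mapping.lookup (F - 1) 0 = 0" using assms by (simp add: lookup_minus)
  then have "Poly_Mapping.lookup ((F - 1) ^ k) (squarefree_monomial S) = 0" if "card S < k" for k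
    using lookup_power_squarefree_eq_0[OF assms(1)] that by blast
  then show "{k. (\<alpha> gchoose k) * Poly_Mapping.lookup ((F - 1) ^ k) (squarefree_monomial S) \<noteq> 0}
      \<subseteq> {..card S}"
    by (auto intro: leI)
qed simp

lemma lookup_of_nat_mult:
  fixes P :: "('v, 'a::comm_semiring_1) mpoly"
  shows "Poly_Mapping.lookup (of_nat c * P) \<mu> = of_nat c * Poly_Mapping.lookup P \<mu>"
  by (induction c) (simp_all add: distrib_right lookup_add)

text \<open>The binomial theorem for \<open>(1 + (F - 1))\<^sup>N\<close>: on either side of the comparison, the terms beyond
  the range of the other sum vanish, because of the degree or because of the binomial coefficient.\<close>

lemma series_power_of_nat:
  fixes F :: "('v, 'a::field_char_0) mpoly"
  assumes "finite S" and "Poly_Mapping.lookup F 0 = 1"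
  shows "series_power F (of_nat N) (squarefree_monomial S)
    = Poly_Mapping.lookup (F ^ N) (squarefree_monomial S)"
proof -
  let ?g = "\<lambda>k. of_nat (N choose k) * Poly_Mapping.lookup ((F - 1) ^ k) (squarefree_monomial S)"
  have "Poly_Mapping.lookup (F - 1) 0 = 0" using assms(2) by (simp add: lookup_minus)
  note g_0 = lookup_power_squarefree_eq_0[OF assms(1) this]
  have "series_power F (of_nat N) (squarefree_monomial S) = (\<Sum>k\<le>card S. ?g k)"
    using assms by (simp add: series_power_squarefree binomial_gbinomial)
  also have "\<dots> = (\<Sum>k\<le>max (card S) N. ?g k)"
    using g_0 by (intro sum.mono_neutral_left) auto
  also have "\<dots> = (\<Sum>k\<le>N. ?g k)"
    by (intro sum.mono_neutral_right) auto
  also have "\<dots> = Poly_Mapping.lookup (\<Sum>k\<le>N. of_nat (N choose k) * (F - 1) ^ k)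
      (squarefree_monomial S)"
    by (simp add: lookup_sum lookup_of_nat_mult)
  also have "(\<Sum>k\<le>N. of_nat (N choose k) * (F - 1) ^ k) = F ^ N"
    using binomial_ring[of "F - 1" 1 N] by simp
  finally show ?thesis .
qed

lemma poly_eq_on_nats:
  fixes p q :: "'a::{idom, ring_char_0} poly"
  assumes "\<And>N. poly p (of_nat N) = poly q (of_nat N)"
  shows "p = q"
proof (rule ccontr)
  assume "p \<noteq> q"
  then have "finite {x. poly (p - q) x = 0}" by (intro poly_roots_finite) simp
  moreover have "range of_nat \<subseteq> {x. poly (p - q) x = 0}" using assms by auto
  ultimately have "finite (range (of_nat :: nat \<Rightarrow> 'a))" using finite_subset by blast
  then show False using inj_of_nat finite_imageD infinite_UNIV_nat by blast
qed

text \<open>Together with the previous lemma, this reduces identities for arbitrary exponents to the case of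
  natural exponents, where the power has a combinatorial meaning.\<close>

lemma series_power_polynomial:
  fixes F :: "('v, 'a::field_char_0) mpoly"
  assumes "finite S" and "Poly_Mapping.lookup F 0 = 1"
  shows "\<exists>p. \<forall>\<alpha>. series_power F \<alpha> (squarefree_monomial S) = poly p \<alpha>"
proof -
  \<comment> \<open>The binomial coefficient \<open>\<alpha> gchoose k\<close> as a polynomial in \<open>\<alpha>\<close>.\<close>
  define b :: "nat \<Rightarrow> 'a poly" where
    "b k = smult (1 / fact k) (\<Prod>i=0..<k. [:- of_nat i, 1:])" for k
  have "poly (b k) \<alpha> = \<alpha> gchoose k" for k \<alpha>
    by (simp add: b_def poly_prod gbinomial_prod_rev algebra_simps)
  then show ?thesis
    using assms
    by (intro exI[of _ "\<Sum>k\<le>card S. smult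
        (Poly_Mapping.lookup ((F - 1) ^ k) (squarefree_monomial S)) (b k)"])
      (simp add: series_power_squarefree poly_sum mult.commute)
qed

section \<open>Components\<close>

abbreviation adjacency :: "('v, 'e) multigraph \<Rightarrow> 'e set \<Rightarrow> ('v \<times> 'v) set"
  where "adjacency G A \<equiv> {(a, b). \<exists>e \<in> A. ends G e = {a, b}}"

lemma sym_rtrancl_adjacency: "sym ((adjacency G A)\<^sup>*)"
  by (rule sym_rtrancl) (auto simp: sym_def insert_commute)

lemma equiv_same_component: "equiv (verts G) (same_component G A)"
proof (rule equivI)
  show "same_component G A \<subseteq> verts G \<times> verts G"
    by (auto simp: same_component_def)
  show "refl_on (verts G) (same_component G A)"
    by (auto simp: same_component_def refl_on_def)
  show "sym (same_component G A)"
    using sym_rtrancl_adjacency[of A G] by (auto simp: same_component_def sym_def)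
  show "trans (same_component G A)"
    unfolding same_component_def trans_def using rtrancl_trans by fast
qed

lemma finite_components: "finite (verts G) \<Longrightarrow> finite (verts G // same_component G A)"
  using equiv_same_component[of G A] by (intro finite_quotient) (auto simp: equiv_def)

lemma num_components_pos:
  assumes "finite (verts G)" "verts G \<noteq> {}"
  shows "num_components G A > 0"
  using assms finite_components[of G A]
  by (simp add: num_components_def card_gt_0_iff quotient_is_empty)

lemma num_components_empty: "finite (verts G) \<Longrightarrow> num_components G {} = card (verts G)"
proof -
  have "verts G // same_component G {} = (\<lambda>v. {v}) ` verts G"
    by (auto simp: same_component_def quotient_def image_iff)
  then show ?thesis by (simp add: num_components_def card_image)
qed

lemma num_components_connected:
  assumes "verts G \<noteq> {}"
    and "\<And>u v. u \<in> verts G \<Longrightarrow> v \<in> verts G \<Longrightarrow> u \<noteq> v \<Longrightarrow> \<exists>e \<in> A. ends G e = {u, v}"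
  shows "num_components G A = 1"
proof -
  have "(u, v) \<in> same_component G A" if uv: "u \<in> verts G" "v \<in> verts G" for u v
  proof (cases "u = v")
    case False
    with assms(2)[OF uv] have "(u, v) \<in> adjacency G A" by simp
    then show ?thesis using uv by (auto simp: same_component_def)
  qed (use uv in \<open>simp add: same_component_def\<close>)
  then have "same_component G A = verts G \<times> verts G"
    by (auto simp: same_component_def)
  then have "verts G // same_component G A = {verts G}"
    using assms(1) by (auto simp: quotient_def)
  then show ?thesis by (simp add: num_components_def)
qed

text \<open>A new edge between \<open>u\<close> and \<open>v\<close> can only merge the components of \<open>u\<close> and \<open>v\<close>. So the old components
  other than the one of \<open>u\<close> extend to different new components.\<close>

lemma num_components_insert:
  assumes "finite (verts G)"
  shows "num_components G A \<le> Suc (num_components G (insert e A))"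
proof (cases "\<exists>u v. ends G e = {u, v}")
  case False
  then have "adjacency G (insert e A) = adjacency G A" by auto
  then show ?thesis by (simp add: num_components_def same_component_def)
next
  case True
  then obtain u v where uv: "ends G e = {u, v}" by blast
  let ?r = "adjacency G A"
  let ?R = "same_component G A" and ?R' = "same_component G (insert e A)"
  have adj: "adjacency G (insert e A) = insert (u, v) (insert (v, u) ?r)"
    using uv by (auto simp: doubleton_eq_iff)
  have sym: "(b, a) \<in> ?r\<^sup>*" if "(a, b) \<in> ?r\<^sup>*" for a b
    using sym_rtrancl_adjacency that by (rule symD)
  have R: "(a, b) \<in> ?R \<longleftrightarrow> a \<in> verts G \<and> b \<in> verts G \<and> (a, b) \<in> ?r\<^sup>*" for a b
    by (auto simp: same_component_def)
  have R': "(a, b) \<in> ?R' \<longleftrightarrow> a \<in> verts G \<and> b \<in> verts G \<and>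
      (a, b) \<in> (insert (u, v) (insert (v, u) ?r))\<^sup>*" for a b
    using adj by (simp add: same_component_def)
  \<comment> \<open>The component of \<open>u\<close> before adding the edge; \<open>u\<close> itself need not be a vertex of \<open>G\<close>.\<close>
  define C where "C = {w \<in> verts G. (u, w) \<in> ?r\<^sup>*}"
  have class_image: "?R' `` (?R `` {a}) = ?R' `` {a}" if "a \<in> verts G" for a
  proof (intro equalityI subsetI)
    fix x assume "x \<in> ?R' `` (?R `` {a})"
    then obtain b where "(a, b) \<in> ?R" "(b, x) \<in> ?R'" by blast
    moreover have "?r\<^sup>* \<subseteq> (insert (u, v) (insert (v, u) ?r))\<^sup>*"
      by (intro rtrancl_mono) blast
    ultimately have "(a, b) \<in> ?R'" by (auto simp: R R')
    then show "x \<in> ?R' `` {a}"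
      using \<open>(b, x) \<in> ?R'\<close> equiv_same_component[of G "insert e A"]
      by (auto elim!: equivE dest: transD)
  qed (use that in \<open>auto simp: R\<close>)
  have class_C: "?R `` {a} = C" if "a \<in> verts G" "(a, u) \<in> ?r\<^sup>* \<or> (u, a) \<in> ?r\<^sup>*" for a
  proof -
    have au: "(a, u) \<in> ?r\<^sup>*" "(u, a) \<in> ?r\<^sup>*" using that(2) sym by blast+
    have "(a, w) \<in> ?r\<^sup>* \<longleftrightarrow> (u, w) \<in> ?r\<^sup>*" for w
      using rtrancl_trans[OF au(1), of w] rtrancl_trans[OF au(2), of w] by blast
    moreover have "?R `` {a} = {w \<in> verts G. (a, w) \<in> ?r\<^sup>*}"
      using that(1) by (simp only: set_eq_iff Image_singleton_iff R mem_Collect_eq) blast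
    ultimately show ?thesis by (simp only: C_def)
  qed
  have "inj_on (\<lambda>X. ?R' `` X) (verts G // ?R - {C})"
  proof (rule inj_onI)
    fix X Y assume X: "X \<in> verts G // ?R - {C}" and Y: "Y \<in> verts G // ?R - {C}"
      and eq: "?R' `` X = ?R' `` Y"
    obtain a b where a: "a \<in> verts G" "X = ?R `` {a}" and b: "b \<in> verts G" "Y = ?R `` {b}"
      using X Y by (auto elim!: quotientE)
    from eq have "?R' `` {a} = ?R' `` {b}" using class_image a b by simp
    then have "(a, b) \<in> ?R'"
      using equiv_same_component a(1) b(1) by (meson eq_equiv_class)
    \<comment> \<open>A new path from \<open>a\<close> to \<open>b\<close> is an old one or passes through the new edge. The old parts of
      the path before and after that edge then reach \<open>u\<close> from \<open>a\<close> or \<open>b\<close> from \<open>u\<close>, or they meet in \<open>v\<close>.\<close>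
    then have "(a, b) \<in> ?r\<^sup>* \<or> (a, u) \<in> ?r\<^sup>* \<or> (u, b) \<in> ?r\<^sup>*"
      by (auto simp: R' rtrancl_insert dest: rtrancl_trans)
    moreover have "(a, u) \<notin> ?r\<^sup>*" using class_C a X by blast
    moreover have "(u, b) \<notin> ?r\<^sup>*" using class_C b Y by blast
    ultimately have "(a, b) \<in> ?R" using a b by (simp add: R)
    then show "X = Y" unfolding a(2) b(2) by (rule equiv_class_eq[OF equiv_same_component])
  qed
  moreover have "(\<lambda>X. ?R' `` X) ` (verts G // ?R - {C}) \<subseteq> verts G // ?R'"
    using class_image by (auto elim!: quotientE intro: quotientI)
  ultimately have "card (verts G // ?R - {C}) \<le> card (verts G // ?R')"
    using finite_components[OF assms] by (metis card_inj_on_le)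
  then show ?thesis
    unfolding num_components_def using card_Diff1_le by (auto simp: card_Diff_singleton_if split: if_splits)
qed

lemma card_verts_le_num_components:
  assumes "finite (verts G)" "finite A"
  shows "card (verts G) \<le> num_components G A + card A"
  using assms(2)
proof (induction A rule: finite_induct)
  case empty
  then show ?case by (simp add: num_components_empty assms(1))
next
  case (insert e A)
  then show ?case using num_components_insert[OF assms(1), of A e] by simp
qed

text \<open>A function that is constant on the components is a function on the set of components.\<close>

lemma card_component_colourings:
  fixes G :: "('v, 'e) multigraph" and K :: "'k set"
  assumes "finite (verts G)"
  shows "card {c \<in> verts G \<rightarrow>\<^sub>E K. \<forall>(u, v) \<in> same_component G A. c u = c v}
    = card K ^ num_components G A"
proof -
  let ?R = "same_component G A"
  note equiv = equiv_same_component[of G A]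
  define lift where "lift d = restrict (\<lambda>v. d (?R `` {v})) (verts G)" for d :: "'v set \<Rightarrow> 'k"
  have inj: "inj_on lift (verts G // ?R \<rightarrow>\<^sub>E K)"
  proof (rule inj_onI)
    fix d d' assume d: "d \<in> verts G // ?R \<rightarrow>\<^sub>E K" "d' \<in> verts G // ?R \<rightarrow>\<^sub>E K"
      and eq: "lift d = lift d'"
    show "d = d'"
    proof (rule PiE_ext[OF d])
      fix X assume "X \<in> verts G // ?R"
      then obtain v where "v \<in> verts G" "X = ?R `` {v}" by (auto elim: quotientE)
      then show "d X = d' X" using fun_cong[OF eq, of v] by (simp add: lift_def)
    qed
  qed
  have image: "lift ` (verts G // ?R \<rightarrow>\<^sub>E K)
      = {c \<in> verts G \<rightarrow>\<^sub>E K. \<forall>(u, v) \<in> ?R. c u = c v}" (is "_ = ?C")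
  proof (intro equalityI subsetI)
    fix c assume "c \<in> lift ` (verts G // ?R \<rightarrow>\<^sub>E K)"
    then obtain d where d: "d \<in> verts G // ?R \<rightarrow>\<^sub>E K" "c = lift d" by blast
    have "c u = c v" if "(u, v) \<in> ?R" for u v
    proof -
      have "u \<in> verts G" "v \<in> verts G" using that by (auto simp: same_component_def)
      then show ?thesis using equiv_class_eq[OF equiv that] by (simp add: d(2) lift_def)
    qed
    moreover have "c \<in> verts G \<rightarrow>\<^sub>E K"
    proof (rule PiE_I)
      fix v assume "v \<in> verts G"
      then show "c v \<in> K"
        using PiE_mem[OF d(1), of "?R `` {v}"] by (simp add: d(2) lift_def quotientI)
    qed (simp add: d(2) lift_def)
    ultimately show "c \<in> ?C" by blast
  next
    fix c assume "c \<in> ?C"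
    then have c: "c \<in> verts G \<rightarrow>\<^sub>E K" and const: "\<And>u v. (u, v) \<in> ?R \<Longrightarrow> c u = c v" by blast+
    define d where "d = restrict (\<lambda>X. c (SOME u. u \<in> X)) (verts G // ?R)"
    have some: "(v, SOME u. u \<in> ?R `` {v}) \<in> ?R" if "v \<in> verts G" for v
      using someI[of "\<lambda>u. u \<in> ?R `` {v}" v] equiv_class_self[OF equiv that] by blast
    have "d (?R `` {v}) = c v" if "v \<in> verts G" for v
      using const[OF some[OF that]] that by (simp add: d_def quotientI)
    then have "lift d = c"
      using c by (auto simp: lift_def restrict_def PiE_def extensional_def)
    moreover have "d \<in> verts G // ?R \<rightarrow>\<^sub>E K"
    proof (rule PiE_I)
      fix X assume X: "X \<in> verts G // ?R"
      then obtain v where "v \<in> verts G" "X = ?R `` {v}" by (auto elim: quotientE)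
      then show "d X \<in> K"
        using const[OF some] X PiE_mem[OF c, of v] by (simp add: d_def)
    qed (simp add: d_def)
    ultimately show "c \<in> lift ` (verts G // ?R \<rightarrow>\<^sub>E K)" by blast
  qed
  have "card ?C = card (verts G // ?R \<rightarrow>\<^sub>E K)"
    using card_image[OF inj] unfolding image .
  then show ?thesis
    using finite_components[OF assms] by (simp add: card_PiE num_components_def)
qed

text \<open>Its edges are the pairs themselves, so that a set of pairs serves both as an index set of
  monomials in the \<open>q\<^sub>i\<^sub>j\<close> and as an edge set.\<close>

definition complete_graph :: "nat \<Rightarrow> (nat, nat \<times> nat) multigraph"
  where "complete_graph n = \<lparr>verts = {1..n}, edges = index_pairs n, ends = (\<lambda>(i, j). {i, j})\<rparr>"

lemma complete_graph_simps [simp]: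
  "verts (complete_graph n) = {1..n}" "ends (complete_graph n) (i, j) = {i, j}"
  by (simp_all add: complete_graph_def)

lemma finite_index_pairs [simp]: "finite (index_pairs n)"
  by (rule finite_subset[of _ "{1..n} \<times> {1..n}"]) (auto simp: index_pairs_def)

lemma card_edge_colourings:
  assumes "A \<subseteq> index_pairs n"
  shows "card {c \<in> {1..n} \<rightarrow>\<^sub>E {..<k::nat}. \<forall>(i, j) \<in> A. c i = c j}
    = k ^ num_components (complete_graph n) A"
proof -
  let ?G = "complete_graph n"
  have "(\<forall>(i, j) \<in> A. c i = c j) \<longleftrightarrow> (\<forall>(u, v) \<in> same_component ?G A. c u = c v)"
    for c :: "nat \<Rightarrow> nat"
  proof (intro iffI ballI; clarify)
    fix u v assume const: "\<forall>(i, j) \<in> A. c i = c j" and "(u, v) \<in> same_component ?G A"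
    then have "(u, v) \<in> (adjacency ?G A)\<^sup>*" by (simp add: same_component_def)
    then show "c u = c v"
      using const by (induction rule: rtrancl_induct) (fastforce simp: doubleton_eq_iff)+
  next
    fix i j assume "\<forall>(u, v) \<in> same_component ?G A. c u = c v" and ij: "(i, j) \<in> A"
    moreover have "(i, j) \<in> adjacency ?G A" using ij by (auto intro: bexI[of _ "(i, j)"])
    then have "(i, j) \<in> same_component ?G A"
      using ij assms by (auto simp: same_component_def index_pairs_def)
    ultimately show "c i = c j" by blast
  qed
  then show ?thesis
    using card_component_colourings[of ?G "{..<k}" A] by simp
qed

text \<open>Parallel edges do not affect connectivity.\<close>

lemma num_components_complete_multigraph:
  "num_components (complete_multigraph n m) B
    = num_components (complete_graph n) ((\<lambda>(i, j, k). (i, j)) ` B)"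
proof -
  have "adjacency (complete_multigraph n m) B
      = adjacency (complete_graph n) ((\<lambda>(i, j, k). (i, j)) ` B)"
  proof (intro equalityI subsetI; clarify)
    fix a b i j k assume "(i, j, k) \<in> B" "ends (complete_multigraph n m) (i, j, k) = {a, b}"
    then show "\<exists>e \<in> (\<lambda>(i, j, k). (i, j)) ` B. ends (complete_graph n) e = {a, b}"
      by (intro bexI[of _ "(i, j)"])
        (auto simp: complete_multigraph_def intro: image_eqI[of _ _ "(i, j, k)"])
  next
    fix a b i j k assume "(i, j, k) \<in> B" "ends (complete_graph n) (i, j) = {a, b}"
    then show "\<exists>e \<in> B. ends (complete_multigraph n m) e = {a, b}"
      by (intro bexI[of _ "(i, j, k)"]) (simp_all add: complete_multigraph_def)
  qed
  then show ?thesis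
    by (simp add: num_components_def same_component_def complete_multigraph_def)
qed

lemma num_components_complete_graph:
  assumes "n \<ge> 1"
  shows "num_components (complete_graph n) (index_pairs n) = 1"
proof (rule num_components_connected)
  fix u v assume "u \<in> verts (complete_graph n)" "v \<in> verts (complete_graph n)" "u \<noteq> v"
  then have "(u, v) \<in> index_pairs n \<or> (v, u) \<in> index_pairs n"
    by (cases "u < v") (simp_all add: index_pairs_def)
  then show "\<exists>e \<in> index_pairs n. ends (complete_graph n) e = {u, v}"
    by (metis complete_graph_simps(2) insert_commute)
qed (use assms in simp)

section \<open>The coefficient of \<open>t\<^sub>1 \<cdots> t\<^sub>n\<close> as a sum over subgraphs\<close>

text \<open>The product over the monochromatic pairs expands into a sum over the sets \<open>A\<close> of monochromatic
  pairs. After exchanging the sums, \<open>A\<close> is counted once for every colouring that is constant on the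
  edges in \<open>A\<close>, and there are \<open>k^\<kappa>(A)\<close> of these.\<close>

lemma sum_monochromatic_products:
  fixes w :: "nat \<Rightarrow> nat \<Rightarrow> 'a::comm_ring_1"
  shows "(\<Sum>c \<in> {1..n} \<rightarrow>\<^sub>E {..<k::nat}. \<Prod>(i, j)\<in>index_pairs n. if c i = c j then w i j + 1 else 1)
    = (\<Sum>A\<in>Pow (index_pairs n). (\<Prod>(i, j)\<in>A. w i j) * of_nat k ^ num_components (complete_graph n) A)"
proof -
  let ?C = "{1..n} \<rightarrow>\<^sub>E {..<k}"
  have fin: "finite ?C" by (intro finite_PiE) auto
  have "(\<Prod>(i, j)\<in>index_pairs n. if c i = c j then w i j + 1 else 1)
      = (\<Sum>A\<in>Pow (index_pairs n). (\<Prod>(i, j)\<in>A. w i j) * of_bool (\<forall>(i, j)\<in>A. c i = c j))"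
    for c :: "nat \<Rightarrow> nat"
  proof -
    have "(\<Prod>(i, j)\<in>index_pairs n. if c i = c j then w i j + 1 else 1)
        = (\<Prod>e\<in>index_pairs n. w (fst e) (snd e) * of_bool (c (fst e) = c (snd e)) + 1)"
      by (intro prod.cong) auto
    also have "\<dots> = (\<Sum>A\<in>Pow (index_pairs n).
        \<Prod>e\<in>A. w (fst e) (snd e) * of_bool (c (fst e) = c (snd e)))"
      by (simp add: prod_add)
    also have "\<dots> = (\<Sum>A\<in>Pow (index_pairs n).
        (\<Prod>(i, j)\<in>A. w i j) * of_bool (\<forall>(i, j)\<in>A. c i = c j))"
    proof (intro sum.cong refl)
      fix A assume "A \<in> Pow (index_pairs n)"
      then have "finite A" by (auto intro: finite_subset[of A "index_pairs n"])
      then have "(\<Prod>e\<in>A. of_bool (c (fst e) = c (snd e))) = (of_bool (\<forall>(i, j)\<in>A. c i = c j) :: 'a)"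
        by (induction A rule: finite_induct) auto
      then show "(\<Prod>e\<in>A. w (fst e) (snd e) * of_bool (c (fst e) = c (snd e)))
          = (\<Prod>(i, j)\<in>A. w i j) * of_bool (\<forall>(i, j)\<in>A. c i = c j)"
        by (simp add: prod.distrib case_prod_unfold)
    qed
    finally show ?thesis .
  qed
  then have "(\<Sum>c \<in> ?C. \<Prod>(i, j)\<in>index_pairs n. if c i = c j then w i j + 1 else 1)
      = (\<Sum>A\<in>Pow (index_pairs n). (\<Prod>(i, j)\<in>A. w i j)
          * (\<Sum>c \<in> ?C. of_bool (\<forall>(i, j)\<in>A. c i = c j)))"
    by (simp only: sum_distrib_left) (rule sum.swap)
  also have "\<dots> = (\<Sum>A\<in>Pow (index_pairs n).
      (\<Prod>(i, j)\<in>A. w i j) * of_nat k ^ num_components (complete_graph n) A)"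
  proof (intro sum.cong refl)
    fix A assume A: "A \<in> Pow (index_pairs n)"
    have "(\<Sum>c \<in> ?C. of_bool (\<forall>(i, j)\<in>A. c i = c j))
        = (of_nat (card {c \<in> ?C. \<forall>(i, j)\<in>A. c i = c j}) :: 'a)"
      using fin by (simp add: sum_of_bool_eq Int_def)
    then show "(\<Prod>(i, j)\<in>A. w i j) * (\<Sum>c \<in> ?C. of_bool (\<forall>(i, j)\<in>A. c i = c j))
        = (\<Prod>(i, j)\<in>A. w i j) * of_nat k ^ num_components (complete_graph n) A"
      using card_edge_colourings[of A n k] A by simp
  qed
  finally show ?thesis .
qed

lemma mpoly_var_neq_1: "(mpoly_var v :: ('v, int) mpoly) \<noteq> 1"
proof
  assume eq: "(mpoly_var v :: ('v, int) mpoly) = 1"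
  have "Poly_Mapping.single v (1::nat) \<noteq> 0"
    by (metis lookup_single_eq lookup_zero zero_neq_one)
  then show False
    using arg_cong[OF eq, of "\<lambda>p. Poly_Mapping.lookup p (Poly_Mapping.single v 1)"]
    by (simp add: mpoly_var_def lookup_one)
qed

lemma xF_yF_neq: "xF - 1 \<noteq> 0" "yF - 1 \<noteq> 0"
proof -
  have "to_fract (mpoly_var v) - 1 \<noteq> (0 :: (tvar, int) mpoly fract)" for v
  proof -
    have "to_fract (mpoly_var v) \<noteq> (to_fract 1 :: (tvar, int) mpoly fract)"
      using mpoly_var_neq_1[of v] unfolding to_fract_eq_iff .
    then show ?thesis by simp
  qed
  then show "xF - 1 \<noteq> 0" "yF - 1 \<noteq> 0" by blast+
qed

lemma lookup_tutte_base:
  assumes "S \<subseteq> {1..n}"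
  shows "Poly_Mapping.lookup (tutte_base n) (squarefree_monomial S)
    = (\<Prod>(i, j)\<in>index_pairs n. if i \<in> S \<and> j \<in> S then qF i j * (yF - 1) + 1 else 1)
      / (yF - 1) ^ card S"
proof -
  \<comment> \<open>The only exponent vector that yields the monomial of \<open>S\<close> is the indicator function of \<open>S\<close>.\<close>
  define ind where "ind = restrict (\<lambda>j. of_bool (j \<in> S) :: nat) {1..n}"
  define coef where "coef l = (\<Prod>(i, j) \<in> index_pairs n. (qF i j * (yF - 1) + 1) ^ (l i * l j))
        * (yF - 1) powi (- (\<Sum>j \<in> {1..n}. int (l j)))" for l :: "nat \<Rightarrow> nat"
  have fin: "finite S" using assms finite_subset by blast
  have "(\<Sum>j \<in> {1..n}. Poly_Mapping.single j (l j)) = squarefree_monomial S \<longleftrightarrow> l = ind"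
    if l: "l \<in> {1..n} \<rightarrow>\<^sub>E {0, 1}" for l
  proof -
    have lookup: "Poly_Mapping.lookup (\<Sum>j \<in> {1..n}. Poly_Mapping.single j (l j)) v
        = (if v \<in> {1..n} then l v else 0)" for v
      by (simp add: lookup_sum lookup_single when_def)
    show ?thesis
    proof
      assume eq: "(\<Sum>j \<in> {1..n}. Poly_Mapping.single j (l j)) = squarefree_monomial S"
      show "l = ind"
      proof
        fix v
        show "l v = ind v"
          using lookup[of v] PiE_arb[OF l, of v] fin unfolding eq
          by (auto simp: ind_def lookup_squarefree_monomial split: if_splits)
      qed
    next
      assume "l = ind"
      then show "(\<Sum>j \<in> {1..n}. Poly_Mapping.single j (l j)) = squarefree_monomial S"
        using assms fin
        by (intro poly_mapping_eqI, unfold lookup)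
          (auto simp: lookup_squarefree_monomial ind_def)
    qed
  qed
  then have "Poly_Mapping.lookup (tutte_base n) (squarefree_monomial S)
      = (\<Sum>l \<in> {1..n} \<rightarrow>\<^sub>E {0, 1}. if l = ind then coef l else 0)"
    unfolding tutte_base_def lookup_sum coef_def[symmetric]
    by (intro sum.cong refl) (simp add: lookup_single when_def)
  also have "\<dots> = coef ind"
  proof -
    have "ind \<in> {1..n} \<rightarrow>\<^sub>E {0, 1}" by (auto simp: ind_def)
    moreover have "finite ({1..n} \<rightarrow>\<^sub>E {0, 1::nat})" by (intro finite_PiE) auto
    ultimately show ?thesis by simp
  qed
  also have "(\<Sum>j \<in> {1..n}. int (ind j)) = int (card S)"
  proof -
    have "(\<Sum>j \<in> {1..n}. int (ind j)) = (\<Sum>j \<in> {1..n}. of_bool (j \<in> S))"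
      by (simp add: ind_def)
    also have "\<dots> = int (card S)"
      using assms by (simp add: sum_of_bool_eq Int_absorb1)
    finally show ?thesis .
  qed
  then have "coef ind = (\<Prod>(i, j)\<in>index_pairs n. (qF i j * (yF - 1) + 1) ^ (ind i * ind j))
      / (yF - 1) ^ card S"
    by (simp add: coef_def power_int_minus divide_inverse)
  also have "(\<Prod>(i, j)\<in>index_pairs n. (qF i j * (yF - 1) + 1) ^ (ind i * ind j))
      = (\<Prod>(i, j)\<in>index_pairs n. if i \<in> S \<and> j \<in> S then qF i j * (yF - 1) + 1 else 1)"
    by (intro prod.cong refl) (auto simp: ind_def index_pairs_def)
  finally show ?thesis .
qed

text \<open>A colour class \<open>S\<close> contributes the factor \<open>1 + q\<^sub>i\<^sub>j (y - 1)\<close> for every pair inside \<open>S\<close> and the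
  power \<open>(y - 1)^(- |S|)\<close>. Over all classes, this yields the monochromatic pairs and the exponent \<open>- n\<close>.\<close>

lemma lookup_tutte_base_power:
  "Poly_Mapping.lookup (tutte_base n ^ k) (squarefree_monomial {1..n})
    = (\<Sum>A\<in>Pow (index_pairs n). (\<Prod>(i, j)\<in>A. qF i j * (yF - 1))
        * of_nat k ^ num_components (complete_graph n) A) / (yF - 1) ^ n"
proof -
  let ?w = "\<lambda>i j. qF i j * (yF - 1)"
  have "(\<Prod>i<k. Poly_Mapping.lookup (tutte_base n) (squarefree_monomial {v \<in> {1..n}. c v = i}))
      = (\<Prod>(i, j)\<in>index_pairs n. if c i = c j then ?w i j + 1 else 1) / (yF - 1) ^ n"
    if c: "c \<in> {1..n} \<rightarrow>\<^sub>E {..<k}" for c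
  proof -
    have "(\<Prod>a<k. Poly_Mapping.lookup (tutte_base n) (squarefree_monomial {v \<in> {1..n}. c v = a}))
        = (\<Prod>a<k. \<Prod>(i, j)\<in>index_pairs n. if c i = a \<and> c j = a then ?w i j + 1 else 1)
          / (\<Prod>a<k. (yF - 1) ^ card {v \<in> {1..n}. c v = a})"
      unfolding prod_dividef[symmetric]
    proof (rule prod.cong[OF refl])
      fix a
      have "(\<Prod>(i, j)\<in>index_pairs n. if i \<in> {v \<in> {1..n}. c v = a} \<and> j \<in> {v \<in> {1..n}. c v = a}
            then ?w i j + 1 else 1)
          = (\<Prod>(i, j)\<in>index_pairs n. if c i = a \<and> c j = a then ?w i j + 1 else 1)"
        by (intro prod.cong refl) (auto simp: index_pairs_def)
      then show "Poly_Mapping.lookup (tutte_base n) (squarefree_monomial {v \<in> {1..n}. c v = a})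
          = (\<Prod>(i, j)\<in>index_pairs n. if c i = a \<and> c j = a then ?w i j + 1 else 1)
            / (yF - 1) ^ card {v \<in> {1..n}. c v = a}"
        by (subst lookup_tutte_base) (auto simp only:)
    qed
    also have "(\<Prod>a<k. \<Prod>(i, j)\<in>index_pairs n. if c i = a \<and> c j = a then ?w i j + 1 else 1)
        = (\<Prod>e\<in>index_pairs n. \<Prod>a<k. if c (fst e) = a \<and> c (snd e) = a
            then ?w (fst e) (snd e) + 1 else 1)"
      by (subst prod.swap) (simp add: case_prod_unfold)
    also have "\<dots> = (\<Prod>(i, j)\<in>index_pairs n. if c i = c j then ?w i j + 1 else 1)"
    proof (intro prod.cong refl, clarify)
      fix i j assume "(i, j) \<in> index_pairs n"
      then have "c i \<in> {..<k}" using PiE_mem[OF c, of i] by (auto simp: index_pairs_def)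
      have "(\<Prod>a<k. if c i = a \<and> c j = a then ?w i j + 1 else 1)
          = (\<Prod>a<k. if c i = a then if c i = c j then ?w i j + 1 else 1 else 1)"
        by (intro prod.cong) auto
      also have "\<dots> = (if c i = c j then ?w i j + 1 else 1)"
        using \<open>c i \<in> {..<k}\<close> by (subst prod.delta') auto
      finally show "(\<Prod>a<k. if c (fst (i, j)) = a \<and> c (snd (i, j)) = a
            then ?w (fst (i, j)) (snd (i, j)) + 1 else 1)
          = (if c i = c j then ?w i j + 1 else 1)" by (simp only: fst_conv snd_conv)
    qed
    also have "(\<Prod>a<k. (yF - 1) ^ card {v \<in> {1..n}. c v = a}) = (yF - 1) ^ n"
    proof -
      have "(\<Sum>a<k. \<Sum>v | v \<in> {1..n} \<and> c v = a. 1) = (\<Sum>v\<in>{1..n}. 1::nat)"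
        using c by (intro sum.group) auto
      then have "(\<Sum>a<k. card {v \<in> {1..n}. c v = a}) = n" by simp
      then show ?thesis by (simp add: power_sum[symmetric])
    qed
    finally show ?thesis .
  qed
  then have "Poly_Mapping.lookup (tutte_base n ^ k) (squarefree_monomial {1..n})
      = (\<Sum>c \<in> {1..n} \<rightarrow>\<^sub>E {..<k}. (\<Prod>(i, j)\<in>index_pairs n. if c i = c j then ?w i j + 1 else 1)
        / (yF - 1) ^ n)"
    unfolding lookup_power_squarefree[OF finite_atLeastAtMost] by (rule sum.cong[OF refl])
  then show ?thesis
    by (simp only: sum_divide_distrib[symmetric] sum_monochromatic_products)
qed

text \<open>Both sides are polynomials in \<open>\<alpha>\<close>, and for natural numbers \<open>\<alpha>\<close> the previous lemma applies.\<close>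

lemma series_power_tutte_base:
  "series_power (tutte_base n) \<alpha> (squarefree_monomial {1..n})
    = (\<Sum>A\<in>Pow (index_pairs n). (\<Prod>(i, j)\<in>A. qF i j * (yF - 1))
        * \<alpha> ^ num_components (complete_graph n) A) / (yF - 1) ^ n"
proof -
  have const: "Poly_Mapping.lookup (tutte_base n) 0 = 1"
    using lookup_tutte_base[of "{}" n] by (simp add: case_prod_unfold)
  obtain p where p: "\<And>\<alpha>. series_power (tutte_base n) \<alpha> (squarefree_monomial {1..n}) = poly p \<alpha>"
    using series_power_polynomial[OF finite_atLeastAtMost const, of 1 n] by blast
  define r where "r = (\<Sum>A\<in>Pow (index_pairs n).
    monom ((\<Prod>(i, j)\<in>A. qF i j * (yF - 1)) / (yF - 1) ^ n) (num_components (complete_graph n) A))"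
  have r: "poly r \<alpha> = (\<Sum>A\<in>Pow (index_pairs n). (\<Prod>(i, j)\<in>A. qF i j * (yF - 1))
      * \<alpha> ^ num_components (complete_graph n) A) / (yF - 1) ^ n" for \<alpha>
    by (simp add: r_def poly_sum poly_monom sum_divide_distrib)
  have "p = r"
  proof (rule poly_eq_on_nats)
    fix N
    show "poly p (of_nat N) = poly r (of_nat N)"
      using series_power_of_nat[OF finite_atLeastAtMost const, of N 1 n]
      by (simp only: p[symmetric] r lookup_tutte_base_power)
  qed
  then show ?thesis by (simp only: p r)
qed

section \<open>Polynomiality of the expansion\<close>

lemma to_fract_prod: "to_fract (prod f A) = (\<Prod>a\<in>A. to_fract (f a))"
  by (induction A rule: infinite_finite_induct) simp_all

lemma to_fract_power: "to_fract (a ^ k) = to_fract a ^ k"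
  by (induction k) simp_all

lemma mpoly_vars_0 [simp]: "mpoly_vars 0 = {}"
  and mpoly_vars_1 [simp]: "mpoly_vars (1 :: ('v, 'a::comm_ring_1) mpoly) = {}"
  by (simp_all add: mpoly_vars_def)

lemma mpoly_vars_var: "mpoly_vars (mpoly_var v :: ('v, int) mpoly) = {v}"
  by (simp add: mpoly_vars_def mpoly_var_def)

lemma mpoly_vars_add: "mpoly_vars (p + q) \<subseteq> mpoly_vars p \<union> mpoly_vars q"
  using keys_add[of p q] by (auto simp: mpoly_vars_def)

lemma mpoly_vars_diff: "mpoly_vars (p - q) \<subseteq> mpoly_vars p \<union> mpoly_vars q"
  for p q :: "('v, int) mpoly"
  using keys_diff[of p q] by (auto simp: mpoly_vars_def)

lemma mpoly_vars_mult: "mpoly_vars (p * q) \<subseteq> mpoly_vars p \<union> mpoly_vars q"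
proof
  fix v assume "v \<in> mpoly_vars (p * q)"
  then obtain \<mu> \<nu> where "\<mu> \<in> Poly_Mapping.keys p" "\<nu> \<in> Poly_Mapping.keys q"
    "v \<in> Poly_Mapping.keys (\<mu> + \<nu>)"
    using keys_mult[of p q] by (fastforce simp: mpoly_vars_def)
  then show "v \<in> mpoly_vars p \<union> mpoly_vars q"
    using keys_add[of \<mu> \<nu>] by (auto simp: mpoly_vars_def)
qed

lemma mpoly_vars_sum:
  "(\<And>a. a \<in> A \<Longrightarrow> mpoly_vars (f a) \<subseteq> V) \<Longrightarrow> mpoly_vars (\<Sum>a\<in>A. f a) \<subseteq> V"
proof (induction A rule: infinite_finite_induct)
  case (insert a A)
  then show ?case using mpoly_vars_add[of "f a" "sum f A"] by fastforce
qed simp_all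

lemma mpoly_vars_prod:
  fixes f :: "'b \<Rightarrow> ('v, 'a::comm_ring_1) mpoly"
  shows "(\<And>a. a \<in> A \<Longrightarrow> mpoly_vars (f a) \<subseteq> V) \<Longrightarrow> mpoly_vars (\<Prod>a\<in>A. f a) \<subseteq> V"
proof (induction A rule: infinite_finite_induct)
  case (insert a A)
  then show ?case using mpoly_vars_mult[of "f a" "prod f A"] by force
qed simp_all

lemma mpoly_vars_power: "mpoly_vars (p ^ k) \<subseteq> mpoly_vars p"
  for p :: "('v, 'a::comm_ring_1) mpoly"
  using mpoly_vars_prod[of "{..<k}" "\<lambda>_. p" "mpoly_vars p"] by simp

text \<open>For \<^prop>\<open>n \<ge> 1\<close> the subtractions in the exponents do not truncate: a graph with \<open>n\<close> vertices has at
  least one component and at least \<open>n - |A|\<close> many.\<close>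

definition subgraph_expansion :: "nat \<Rightarrow> (tvar, int) mpoly"
  where "subgraph_expansion n = (\<Sum>A\<in>Pow (index_pairs n). (\<Prod>(i, j)\<in>A. mpoly_var (Qv i j))
    * ((mpoly_var Xv - 1) ^ (num_components (complete_graph n) A - 1)
      * (mpoly_var Yv - 1) ^ (num_components (complete_graph n) A + card A - n)))"

lemma mpoly_vars_subgraph_expansion:
  "mpoly_vars (subgraph_expansion n) \<subseteq> {Qv i j |i j. (i, j) \<in> index_pairs n} \<union> {Xv, Yv}"
  (is "_ \<subseteq> ?V")
  unfolding subgraph_expansion_def
proof (rule mpoly_vars_sum)
  fix A assume "A \<in> Pow (index_pairs n)"
  then have q: "mpoly_vars (\<Prod>(i, j)\<in>A. mpoly_var (Qv i j) :: (tvar, int) mpoly) \<subseteq> ?V"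
    by (intro mpoly_vars_prod) (auto simp: mpoly_vars_var)
  have pow: "mpoly_vars ((mpoly_var v - 1) ^ k :: (tvar, int) mpoly) \<subseteq> {v}" for v k
    using mpoly_vars_power[of "mpoly_var v - 1 :: (tvar, int) mpoly" k]
      mpoly_vars_diff[of "mpoly_var v" 1] by (simp add: mpoly_vars_var)
  have xy: "mpoly_vars ((mpoly_var Xv - 1) ^ k :: (tvar, int) mpoly) \<subseteq> ?V"
    "mpoly_vars ((mpoly_var Yv - 1) ^ k :: (tvar, int) mpoly) \<subseteq> ?V" for k
    using pow[of Xv k] pow[of Yv k] by blast+
  show "mpoly_vars ((\<Prod>(i, j)\<in>A. mpoly_var (Qv i j) :: (tvar, int) mpoly)
      * ((mpoly_var Xv - 1) ^ (num_components (complete_graph n) A - 1)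
        * (mpoly_var Yv - 1) ^ (num_components (complete_graph n) A + card A - n))) \<subseteq> ?V"
    by (intro mpoly_vars_mult[THEN subset_trans] Un_least q xy)
qed

lemma to_fract_subgraph_expansion:
  assumes "n \<ge> 1"
  shows "(xF - 1) * to_fract (subgraph_expansion n)
    = series_power (tutte_base n) ((xF - 1) * (yF - 1)) (squarefree_monomial {1..n})"
proof -
  let ?\<kappa> = "\<lambda>A. num_components (complete_graph n) A"
  have "(xF - 1) * ((\<Prod>(i, j)\<in>A. qF i j) * ((xF - 1) ^ (?\<kappa> A - 1) * (yF - 1) ^ (?\<kappa> A + card A - n)))
      = (\<Prod>(i, j)\<in>A. qF i j * (yF - 1)) * ((xF - 1) * (yF - 1)) ^ ?\<kappa> A / (yF - 1) ^ n"
    if "A \<in> Pow (index_pairs n)" for A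
  proof -
    have "finite A" using that by (auto intro: finite_subset[of A "index_pairs n"])
    then have "n \<le> ?\<kappa> A + card A"
      using card_verts_le_num_components[of "complete_graph n" A] by simp
    then have "(yF - 1) ^ (?\<kappa> A + card A) = (yF - 1) ^ (?\<kappa> A + card A - n) * (yF - 1) ^ n"
      by (simp flip: power_add)
    then have y: "(yF - 1) ^ (?\<kappa> A + card A - n) = (yF - 1) ^ card A * (yF - 1) ^ ?\<kappa> A / (yF - 1) ^ n"
      using xF_yF_neq by (simp add: field_simps power_add)
    have "?\<kappa> A > 0"
      using num_components_pos[of "complete_graph n" A] assms by simp
    then have x: "(xF - 1) ^ ?\<kappa> A = (xF - 1) * (xF - 1) ^ (?\<kappa> A - 1)"
      by (simp flip: power_Suc)
    have q: "(\<Prod>(i, j)\<in>A. qF i j * (yF - 1)) = (\<Prod>(i, j)\<in>A. qF i j) * (yF - 1) ^ card A"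
      by (simp add: case_prod_unfold prod.distrib)
    show ?thesis
      unfolding y q power_mult_distrib x by (simp add: mult_ac)
  qed
  then show ?thesis
    unfolding series_power_tutte_base subgraph_expansion_def
    by (simp add: to_fract_prod to_fract_power case_prod_unfold sum_distrib_left
        sum_divide_distrib)
qed

text \<open>The defining equation determines the universal Tutte polynomial, since \<open>x - 1\<close> can be cancelled
  and the polynomial ring embeds into its fraction field.\<close>

lemma universal_tutte_eq_subgraph_expansion:
  assumes "n \<ge> 1"
  shows "universal_tutte n = subgraph_expansion n"
  unfolding universal_tutte_def squarefree_monomial_def[symmetric]
proof (rule the_equality)
  show "mpoly_vars (subgraph_expansion n) \<subseteq> {Qv i j |i j. (i, j) \<in> index_pairs n} \<union> {Xv, Yv} \<and>
    (xF - 1) * to_fract (subgraph_expansion n)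
      = series_power (tutte_base n) ((xF - 1) * (yF - 1)) (squarefree_monomial {1..n})"
    using mpoly_vars_subgraph_expansion to_fract_subgraph_expansion[OF assms] by blast
next
  fix T
  assume "mpoly_vars T \<subseteq> {Qv i j |i j. (i, j) \<in> index_pairs n} \<union> {Xv, Yv} \<and>
    (xF - 1) * to_fract T
      = series_power (tutte_base n) ((xF - 1) * (yF - 1)) (squarefree_monomial {1..n})"
  then have "(xF - 1) * to_fract T = (xF - 1) * to_fract (subgraph_expansion n)"
    using to_fract_subgraph_expansion[OF assms] by simp
  then show "T = subgraph_expansion n"
    using xF_yF_neq(1) by simp
qed

section \<open>Substitution is a ring homomorphism\<close>

definition monomial_value :: "('v \<Rightarrow> 'b::comm_ring_1) \<Rightarrow> ('v \<Rightarrow>\<^sub>0 nat) \<Rightarrow> 'b"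
  where "monomial_value f \<mu> = (\<Prod>v \<in> Poly_Mapping.keys \<mu>. f v ^ Poly_Mapping.lookup \<mu> v)"

lemma monomial_value_superset:
  assumes "finite V" "Poly_Mapping.keys \<mu> \<subseteq> V"
  shows "monomial_value f \<mu> = (\<Prod>v \<in> V. f v ^ Poly_Mapping.lookup \<mu> v)"
  unfolding monomial_value_def using assms
  by (intro prod.mono_neutral_left) (auto simp: in_keys_iff)

lemma monomial_value_add: "monomial_value f (\<mu> + \<nu>) = monomial_value f \<mu> * monomial_value f \<nu>"
proof -
  let ?V = "Poly_Mapping.keys \<mu> \<union> Poly_Mapping.keys \<nu>"
  have "monomial_value f (\<mu> + \<nu>) = (\<Prod>v \<in> ?V. f v ^ Poly_Mapping.lookup (\<mu> + \<nu>) v)"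
    using keys_add[of \<mu> \<nu>] by (intro monomial_value_superset) auto
  also have "\<dots> = (\<Prod>v \<in> ?V. f v ^ Poly_Mapping.lookup \<mu> v) * (\<Prod>v \<in> ?V. f v ^ Poly_Mapping.lookup \<nu> v)"
    by (simp add: lookup_add power_add prod.distrib)
  also have "\<dots> = monomial_value f \<mu> * monomial_value f \<nu>"
    by (simp add: monomial_value_superset[of ?V])
  finally show ?thesis .
qed

lemma mpoly_subst_superset:
  assumes "finite M" "Poly_Mapping.keys p \<subseteq> M"
  shows "mpoly_subst f p = (\<Sum>\<mu> \<in> M. of_int (Poly_Mapping.lookup p \<mu>) * monomial_value f \<mu>)"
  unfolding mpoly_subst_def monomial_value_def[symmetric] using assms
  by (intro sum.mono_neutral_left) (auto simp: in_keys_iff)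

lemma mpoly_subst_add: "mpoly_subst f (p + q) = mpoly_subst f p + mpoly_subst f q"
proof -
  let ?M = "Poly_Mapping.keys p \<union> Poly_Mapping.keys q"
  have "mpoly_subst f (p + q)
      = (\<Sum>\<mu> \<in> ?M. of_int (Poly_Mapping.lookup (p + q) \<mu>) * monomial_value f \<mu>)"
    using keys_add[of p q] by (intro mpoly_subst_superset) auto
  also have "\<dots> = (\<Sum>\<mu> \<in> ?M. of_int (Poly_Mapping.lookup p \<mu>) * monomial_value f \<mu>)
      + (\<Sum>\<mu> \<in> ?M. of_int (Poly_Mapping.lookup q \<mu>) * monomial_value f \<mu>)"
    by (simp add: lookup_add distrib_right sum.distrib)
  also have "\<dots> = mpoly_subst f p + mpoly_subst f q"
    by (simp add: mpoly_subst_superset[of ?M])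
  finally show ?thesis .
qed

lemma mpoly_subst_0 [simp]: "mpoly_subst f 0 = 0"
  by (simp add: mpoly_subst_def)

lemma mpoly_subst_single:
  "mpoly_subst f (Poly_Mapping.single \<mu> c) = of_int c * monomial_value f \<mu>"
  by (simp add: mpoly_subst_superset[of "{\<mu>}"])

lemma mpoly_subst_1 [simp]: "mpoly_subst f 1 = 1"
  using mpoly_subst_single[of f 0 1] by (simp add: monomial_value_def)

lemma mpoly_subst_sum: "mpoly_subst f (\<Sum>a\<in>A. g a) = (\<Sum>a\<in>A. mpoly_subst f (g a))"
  by (induction A rule: infinite_finite_induct) (simp_all add: mpoly_subst_add)

lemma mpoly_eq_sum_single:
  "p = (\<Sum>\<mu> \<in> Poly_Mapping.keys p. Poly_Mapping.single \<mu> (Poly_Mapping.lookup p \<mu>))"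
  by (rule poly_mapping_eqI) (simp add: lookup_sum lookup_single when_def in_keys_iff)

lemma mpoly_subst_mult: "mpoly_subst f (p * q) = mpoly_subst f p * mpoly_subst f q"
proof -
  let ?P = "Poly_Mapping.keys p" and ?Q = "Poly_Mapping.keys q"
  have "p * q = (\<Sum>\<mu> \<in> ?P. Poly_Mapping.single \<mu> (Poly_Mapping.lookup p \<mu>))
      * (\<Sum>\<nu> \<in> ?Q. Poly_Mapping.single \<nu> (Poly_Mapping.lookup q \<nu>))"
    using mpoly_eq_sum_single[of p] mpoly_eq_sum_single[of q] by simp
  also have "mpoly_subst f \<dots> = (\<Sum>\<mu> \<in> ?P. \<Sum>\<nu> \<in> ?Q.
      (of_int (Poly_Mapping.lookup p \<mu>) * monomial_value f \<mu>)
      * (of_int (Poly_Mapping.lookup q \<nu>) * monomial_value f \<nu>))"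
    by (simp add: sum_product mpoly_subst_sum mult_single mpoly_subst_single monomial_value_add
        mult_ac)
  also have "\<dots> = mpoly_subst f p * mpoly_subst f q"
    by (simp add: sum_product mpoly_subst_def monomial_value_def)
  finally show ?thesis .
qed

lemma mpoly_subst_diff: "mpoly_subst f (p - q) = mpoly_subst f p - mpoly_subst f q"
  using mpoly_subst_add[of f "p - q" q] by (simp add: algebra_simps)

lemma mpoly_subst_power: "mpoly_subst f (p ^ k) = mpoly_subst f p ^ k"
  by (induction k) (simp_all add: mpoly_subst_mult)

lemma mpoly_subst_prod: "mpoly_subst f (\<Prod>a\<in>A. g a) = (\<Prod>a\<in>A. mpoly_subst f (g a))"
  by (induction A rule: infinite_finite_induct) (simp_all add: mpoly_subst_mult)

lemma mpoly_subst_var: "mpoly_subst f (mpoly_var v) = f v"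
  by (simp add: mpoly_var_def mpoly_subst_single monomial_value_def)

lemma specialize_subgraph_expansion:
  "specialize c (subgraph_expansion n) = (\<Sum>A\<in>Pow (index_pairs n). (\<Prod>(i, j)\<in>A. c i j)
    * ((x_poly - 1) ^ (num_components (complete_graph n) A - 1)
      * (y_poly - 1) ^ (num_components (complete_graph n) A + card A - n)))"
  by (simp add: specialize_def subgraph_expansion_def mpoly_subst_sum mpoly_subst_mult
      mpoly_subst_prod mpoly_subst_power mpoly_subst_diff mpoly_subst_var case_prod_unfold)

lemma y_poly_neq_1: "y_poly - 1 \<noteq> 0"
  by (simp add: y_poly_def one_pCons)

lemma y_number_mult: "y_number k * (y_poly - 1) = y_poly ^ k - 1"
proof -
  have "y_poly - 1 dvd y_poly ^ k - 1"
    using power_diff_1_eq[of y_poly k] by simp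
  then show ?thesis by (simp add: y_number_def)
qed

section \<open>Edge sets of the complete multigraph\<close>

text \<open>An edge set with support \<open>P\<close> is a choice of a nonempty set of parallel edges for each pair in \<open>P\<close>.
  The nonempty subsets of a set of \<open>m\<close> edges have total weight \<open>(z + 1)\<^sup>m - 1\<close>.\<close>

lemma sum_power_card_support:
  fixes z :: "'a::comm_ring_1"
  assumes "finite P"
  shows "(\<Sum>B | B \<subseteq> {(i, j, k). k < m i j} \<and> (\<lambda>(i, j, k). (i, j)) ` B = P. z ^ card B)
    = (\<Prod>(i, j)\<in>P. (z + 1) ^ m i j - 1)"
proof -
  define F where "F = (\<lambda>(i, j). Pow {..<m i j :: nat} - {{}})"
  have finF: "finite (F e)" for e by (simp add: F_def case_prod_unfold)
  have "(z + 1) ^ r - 1 = (\<Sum>S \<in> Pow {..<r} - {{}}. z ^ card S)" for r :: nat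
  proof -
    have "(z + 1) ^ r = (\<Sum>S \<in> Pow {..<r}. z ^ card S)"
      using prod_add[of "{..<r}" "\<lambda>_. z" "\<lambda>_. 1"] by simp
    then show ?thesis by (subst sum_diff) auto
  qed
  then have "(\<Prod>(i, j)\<in>P. (z + 1) ^ m i j - 1) = (\<Prod>e\<in>P. \<Sum>S \<in> F e. z ^ card S)"
    by (simp add: F_def case_prod_unfold)
  also have "\<dots> = (\<Sum>s \<in> Pi\<^sub>E P F. \<Prod>e\<in>P. z ^ card (s e))"
    using assms finF by (intro prod_sum_PiE) auto
  also have "\<dots> = (\<Sum>B | B \<subseteq> {(i, j, k). k < m i j} \<and> (\<lambda>(i, j, k). (i, j)) ` B = P. z ^ card B)"
  proof (rule sum.reindex_bij_witness[where
        i = "\<lambda>B. restrict (\<lambda>(i, j). {k. (i, j, k) \<in> B}) P"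
        and j = "\<lambda>s. {(i, j, k). (i, j) \<in> P \<and> k \<in> s (i, j)}"], goal_cases)
    case (1 s)
    show ?case
    proof
      fix e
      show "restrict (\<lambda>(i, j). {k. (i, j, k) \<in> {(i, j, k). (i, j) \<in> P \<and> k \<in> s (i, j)}}) P e = s e"
        using PiE_arb[OF 1, of e] by (cases e) (simp add: restrict_def)
    qed
  next
    case (2 s)
    have s: "s (i, j) \<subseteq> {..<m i j}" "s (i, j) \<noteq> {}" if "(i, j) \<in> P" for i j
      using PiE_mem[OF 2 that] by (auto simp: F_def)
    have "(i, j) \<in> (\<lambda>(i, j, k). (i, j)) ` {(i, j, k). (i, j) \<in> P \<and> k \<in> s (i, j)}"
      if ij: "(i, j) \<in> P" for i j
    proof -
      obtain k where "k \<in> s (i, j)" using s(2)[OF ij] by blast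
      then show ?thesis using ij by (intro image_eqI[of _ _ "(i, j, k)"]) auto
    qed
    moreover have "k < m i j" if "(i, j) \<in> P" "k \<in> s (i, j)" for i j k
      using s(1)[OF that(1)] that(2) by blast
    ultimately show ?case by auto
  next
    case (3 B)
    then have "(i, j) \<in> P" if "(i, j, k) \<in> B" for i j k
      using that by (auto intro: image_eqI[of _ _ "(i, j, k)"])
    then show ?case by auto
  next
    case (4 B)
    show ?case
    proof (rule PiE_I)
      fix e assume "e \<in> P"
      then obtain i j k where "e = (i, j)" "(i, j, k) \<in> B" using 4 by auto
      then show "restrict (\<lambda>(i, j). {k. (i, j, k) \<in> B}) P e \<in> F e"
        using 4 \<open>e \<in> P\<close> by (auto simp: F_def)
    qed simp
  next
    case (5 s)
    have fin: "finite (s e)" if "e \<in> P" for e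
      using PiE_mem[OF 5 that] by (auto simp: F_def case_prod_unfold intro: finite_subset)
    have "{(i, j, k). (i, j) \<in> P \<and> k \<in> s (i, j)} = (\<lambda>(e, k). (fst e, snd e, k)) ` Sigma P s"
      by (force simp: image_iff)
    moreover have "inj_on (\<lambda>(e, k). (fst e, snd e, k)) (Sigma P s)"
      by (auto simp: inj_on_def)
    ultimately have "card {(i, j, k). (i, j) \<in> P \<and> k \<in> s (i, j)} = (\<Sum>e\<in>P. card (s e))"
      using assms fin by (simp add: card_image)
    then show ?case by (simp add: power_sum)
  qed
  finally show ?thesis by simp
qed

text \<open>The edge sets are grouped by their supports. The factor \<open>(y - 1)\<^sup>n\<close> makes all exponents sums, so
  that \<open>(y - 1)^|B|\<close> can be split off and summed over the edge sets \<open>B\<close> with a given support.\<close>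

lemma tutte_poly_complete_multigraph:
  assumes "n \<ge> 1" and "\<And>i j. (i, j) \<in> index_pairs n \<Longrightarrow> m i j > 0"
  shows "(y_poly - 1) ^ n * tutte_poly (complete_multigraph n m)
    = (\<Sum>A\<in>Pow (index_pairs n). (\<Prod>(i, j)\<in>A. y_poly ^ m i j - 1)
      * ((x_poly - 1) ^ (num_components (complete_graph n) A - 1)
        * (y_poly - 1) ^ num_components (complete_graph n) A))"
proof -
  let ?G = "complete_multigraph n m" and ?\<pi> = "\<lambda>(i, j, k :: nat). (i, j) :: nat \<times> nat"
  let ?\<kappa> = "num_components (complete_graph n)"
  define E where "E = edges ?G"
  have E: "E = {(i, j, k). (i, j) \<in> index_pairs n \<and> k < m i j}"
    by (simp add: E_def complete_multigraph_def)
  have "E \<subseteq> (\<lambda>(e, k). (fst e, snd e, k)) ` (SIGMA e : index_pairs n. {..<m (fst e) (snd e)})"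
  proof clarify
    fix i j k assume "(i, j, k) \<in> E"
    then show "(i, j, k) \<in> (\<lambda>(e, k). (fst e, snd e, k))
        ` (SIGMA e : index_pairs n. {..<m (fst e) (snd e)})"
      by (intro image_eqI[of _ _ "((i, j), k)"]) (simp_all add: E)
  qed
  then have fin: "finite E" by (rule finite_subset) simp
  \<comment> \<open>Here the positivity of the multiplicities enters: every pair of vertices is joined by an edge.\<close>
  have "?\<pi> ` E = index_pairs n"
  proof
    show "index_pairs n \<subseteq> ?\<pi> ` E"
    proof
      fix e assume e: "e \<in> index_pairs n"
      obtain i j where ij: "e = (i, j)" by (cases e)
      then have "(i, j, 0) \<in> E" using assms(2) e by (simp add: E)
      then show "e \<in> ?\<pi> ` E" using ij by (intro image_eqI[of _ _ "(i, j, 0)"]) auto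
    qed
  qed (auto simp: E)
  then have \<kappa>E: "num_components ?G E = 1"
    using num_components_complete_graph[OF assms(1)]
    by (simp add: num_components_complete_multigraph)
  have "(y_poly - 1) ^ n * tutte_poly ?G
      = (\<Sum>B\<in>Pow E. (y_poly - 1) ^ card B
          * ((x_poly - 1) ^ (?\<kappa> (?\<pi> ` B) - 1) * (y_poly - 1) ^ ?\<kappa> (?\<pi> ` B)))"
    unfolding tutte_poly_def E_def[symmetric] \<kappa>E sum_distrib_left
  proof (intro sum.cong refl)
    fix B assume "B \<in> Pow E"
    then have "finite B" using fin finite_subset by blast
    then have "n \<le> num_components ?G B + card B"
      using card_verts_le_num_components[of ?G B] by (simp add: complete_multigraph_def)
    then have "(y_poly - 1) ^ n * (y_poly - 1) ^ (num_components ?G B + card B - n)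
        = (y_poly - 1) ^ (num_components ?G B + card B)"
      by (simp flip: power_add)
    then show "(y_poly - 1) ^ n * ((x_poly - 1) ^ (num_components ?G B - 1)
          * (y_poly - 1) ^ (num_components ?G B + card B - card (verts ?G)))
        = (y_poly - 1) ^ card B
          * ((x_poly - 1) ^ (?\<kappa> (?\<pi> ` B) - 1) * (y_poly - 1) ^ ?\<kappa> (?\<pi> ` B))"
      by (simp add: complete_multigraph_def[of n m, THEN arg_cong, of verts]
          num_components_complete_multigraph power_add mult_ac)
  qed
  also have "\<dots> = (\<Sum>A\<in>Pow (index_pairs n). \<Sum>B | B \<in> Pow E \<and> ?\<pi> ` B = A. (y_poly - 1) ^ card B
          * ((x_poly - 1) ^ (?\<kappa> (?\<pi> ` B) - 1) * (y_poly - 1) ^ ?\<kappa> (?\<pi> ` B)))"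
    using fin by (intro sum.group[symmetric]) (auto simp: E)
  also have "\<dots> = (\<Sum>A\<in>Pow (index_pairs n). (\<Prod>(i, j)\<in>A. y_poly ^ m i j - 1)
      * ((x_poly - 1) ^ (?\<kappa> A - 1) * (y_poly - 1) ^ ?\<kappa> A))"
  proof (intro sum.cong refl)
    fix A assume A: "A \<in> Pow (index_pairs n)"
    then have "finite A" by (auto intro: finite_subset[of A "index_pairs n"])
    have "{B. B \<in> Pow E \<and> ?\<pi> ` B = A} = {B. B \<subseteq> {(i, j, k). k < m i j} \<and> ?\<pi> ` B = A}"
      using A by (force simp: E)
    then have "(\<Sum>B | B \<in> Pow E \<and> ?\<pi> ` B = A. (y_poly - 1) ^ card B)
        = (\<Prod>(i, j)\<in>A. y_poly ^ m i j - 1)"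
      using sum_power_card_support[OF \<open>finite A\<close>, of "y_poly - 1" m] by simp
    then show "(\<Sum>B | B \<in> Pow E \<and> ?\<pi> ` B = A. (y_poly - 1) ^ card B
          * ((x_poly - 1) ^ (?\<kappa> (?\<pi> ` B) - 1) * (y_poly - 1) ^ ?\<kappa> (?\<pi> ` B)))
        = (\<Prod>(i, j)\<in>A. y_poly ^ m i j - 1)
          * ((x_poly - 1) ^ (?\<kappa> A - 1) * (y_poly - 1) ^ ?\<kappa> A)"
      by (simp flip: sum_distrib_right)
  qed
  finally show ?thesis .
qed

theorem corollary4p2:
  fixes n :: nat and m :: "nat \<Rightarrow> nat \<Rightarrow> nat"
  assumes "n \<ge> 1"
    and "\<And>i j. (i, j) \<in> index_pairs n \<Longrightarrow> m i j > 0"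
  shows "specialize (\<lambda>i j. y_number (m i j)) (universal_tutte n)
    = tutte_poly (complete_multigraph n m)"
proof -
  let ?\<kappa> = "num_components (complete_graph n)"
  have "(y_poly - 1) ^ n * specialize (\<lambda>i j. y_number (m i j)) (universal_tutte n)
      = (\<Sum>A\<in>Pow (index_pairs n). (\<Prod>(i, j)\<in>A. y_poly ^ m i j - 1)
        * ((x_poly - 1) ^ (?\<kappa> A - 1) * (y_poly - 1) ^ ?\<kappa> A))"
    unfolding universal_tutte_eq_subgraph_expansion[OF assms(1)] specialize_subgraph_expansion
      sum_distrib_left
  proof (intro sum.cong refl)
    fix A assume "A \<in> Pow (index_pairs n)"
    then have "finite A" by (auto intro: finite_subset[of A "index_pairs n"])
    then have "n \<le> ?\<kappa> A + card A"
      using card_verts_le_num_components[of "complete_graph n" A] by simp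
    then have y: "(y_poly - 1) ^ n * (y_poly - 1) ^ (?\<kappa> A + card A - n)
        = (y_poly - 1) ^ ?\<kappa> A * (y_poly - 1) ^ card A"
      by (simp flip: power_add)
    have q: "(\<Prod>(i, j)\<in>A. y_poly ^ m i j - 1) = (\<Prod>(i, j)\<in>A. y_number (m i j)) * (y_poly - 1) ^ card A"
      unfolding y_number_mult[symmetric] case_prod_unfold prod.distrib by simp
    have "(y_poly - 1) ^ n * ((\<Prod>(i, j)\<in>A. y_number (m i j))
          * ((x_poly - 1) ^ (?\<kappa> A - 1) * (y_poly - 1) ^ (?\<kappa> A + card A - n)))
        = ((y_poly - 1) ^ n * (y_poly - 1) ^ (?\<kappa> A + card A - n))
          * ((\<Prod>(i, j)\<in>A. y_number (m i j)) * (x_poly - 1) ^ (?\<kappa> A - 1))"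
      by (simp only: mult_ac)
    also have "\<dots> = (\<Prod>(i, j)\<in>A. y_poly ^ m i j - 1)
          * ((x_poly - 1) ^ (?\<kappa> A - 1) * (y_poly - 1) ^ ?\<kappa> A)"
      unfolding y q by (simp only: mult_ac)
    finally show "(y_poly - 1) ^ n * ((\<Prod>(i, j)\<in>A. y_number (m i j))
          * ((x_poly - 1) ^ (?\<kappa> A - 1) * (y_poly - 1) ^ (?\<kappa> A + card A - n)))
        = (\<Prod>(i, j)\<in>A. y_poly ^ m i j - 1)
          * ((x_poly - 1) ^ (?\<kappa> A - 1) * (y_poly - 1) ^ ?\<kappa> A)" .
  qed
  also have "\<dots> = (y_poly - 1) ^ n * tutte_poly (complete_multigraph n m)"
    using tutte_poly_complete_multigraph[OF assms] by simp
  finally show ?thesis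
    using y_poly_neq_1 by simp
qed

end
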